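(* Let $S\colon\mathbb{N}\to\mathbb{Z}$ be a simple random walk. For every $\varepsilon>0$, for all $n$ large enough, $$\mathbb{P}\left(\operatorname{LIS}(S|_{[0,n)})<\varepsilon\sqrt{n}\log_2 n\right)\leq 250\,\varepsilon.$$ Consequently, for all large enough $n$, $$\mathbb{E}\left(\operatorname{LIS}(S|_{[0,n)})\right)\geq \frac{1}{1000}\sqrt{n}\log_2 n.$$
   Context: $\mathbb{N}=\{0,1,2,\dots\}$, and $[0,n)$ denotes $\{0,1,\dots,n-1\}$. The simple random walk is $S(n)=\sum_{i=1}^n X_i$ (so $S(0)=0$) with $X_i$ i.i.d. and $\mathbb{P}(X_1=1)=\mathbb{P}(X_1=-1)=1/2$. For $S\colon\mathbb{N}\to\mathbb{R}$ and $A\subset\mathbb{N}$, $S|_A$ is called increasing if $S(a)\le S(b)$ for all $a,b\in A$ with $a\le b$ (weakly increasing). Define $\operatorname{LIS}(S|_{[0,n)})=\max\{|A|: A\subset[0,n),\ S|_A \text{ is increasing}\}$. *)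

theory Defs
  imports "HOL-Probability.Probability"
begin

text \<open>The steps are indexed by the positive integers; \<open>X 0\<close> is unconstrained and unused.
  Measurability of each step is part of \<open>indep_vars\<close>.\<close>

locale simple_random_walk = prob_space M for M :: "'a measure" +
  fixes X :: "nat \<Rightarrow> 'a \<Rightarrow> int"
  assumes indep_steps: "indep_vars (\<lambda>_. count_space UNIV) X {1..}"
    and prob_step_up: "\<And>i. i \<ge> 1 \<Longrightarrow> prob {\<omega> \<in> space M. X i \<omega> = 1} = 1 / 2"
    and prob_step_down: "\<And>i. i \<ge> 1 \<Longrightarrow> prob {\<omega> \<in> space M. X i \<omega> = - 1} = 1 / 2"

definition walk :: "(nat \<Rightarrow> 'a \<Rightarrow> int) \<Rightarrow> nat \<Rightarrow> 'a \<Rightarrow> int" where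
  "walk X n \<omega> = (\<Sum>i = 1..n. X i \<omega>)"

text \<open>Length of a longest weakly increasing subsequence of \<open>S\<close> restricted to \<open>B\<close>, meant for
  finite \<open>B\<close> only (the maximum is then over a finite set containing \<open>0\<close>).\<close>

definition LIS :: "(nat \<Rightarrow> 'b::linorder) \<Rightarrow> nat set \<Rightarrow> nat" where
  "LIS S B = Max {card A |A. A \<subseteq> B \<and> mono_on A S}"

end

theory Submission
  imports Defs
begin

text \<open>A walk that reaches height \<open>N = 2 ^ J\<close> contains, just before it does so, a \<^emph>\<open>crossing\<close>: a
  stretch from \<open>0\<close> to \<open>N\<close> whose interior stays strictly between \<open>0\<close> and \<open>N\<close>. Crossings are
  self-similar. Cutting a crossing of \<open>2 * m\<close> at its first and its last visit to \<open>m\<close> leaves two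
  independent crossings of \<open>m\<close> with a loop at \<open>m\<close> between them. A chain of increasing indices
  may use an increasing subsequence of the first half, then wait at level \<open>m\<close> and take \<^emph>\<open>every\<close> visit
  to \<open>m\<close>, then use an increasing subsequence of the second half. The number of visits is
  geometric with mean \<open>m\<close>, so the expected length \<open>b j\<close> for crossings of \<open>2 ^ j\<close>
  satisfies \<open>b (j + 1) \<ge> 2 * b j + 2 ^ j\<close>, whence \<open>b J\<close> is at least \<open>J * 2 ^ J / 2\<close>. Taking
  \<open>2 ^ J\<close> of order \<open>sqrt n\<close> produces the logarithm.

  Lower deviations are controlled by Laplace transforms. Give a path of length \<open>k\<close> the weight
  \<open>(1/2) ^ k\<close>. Weights are multiplicative under concatenation, which expresses the Markov property,
  and the estimates are for finite sums over lists of steps, uniform in the maximal length. The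
  cutting at \<open>m\<close> gives the recursive inequality \<open>crossing_gf_double\<close> for the generating function of the longest increasing subsequence, which
  \<open>crossing_gf_le\<close> solves. A Green function estimate \<open>green_weight_le\<close> accounts for where the
  crossing starts and cancels its total weight \<open>1 / (2 * N)\<close> exactly
  (\<open>hitting_small_LIS_fraction_le\<close>). The walk fails to reach \<open>N\<close> within \<open>n\<close> steps with probability
  at most \<open>2 * N / sqrt n\<close> (\<open>staying_below_fraction_le_sqrt\<close>).

  For given \<open>\<epsilon>\<close> the scale \<open>N\<close> is a power of two between \<open>32 * \<epsilon> * sqrt n\<close> and
  \<open>64 * \<epsilon> * sqrt n\<close>. Failing to reach it then costs at most \<open>128 * \<epsilon>\<close>, and the deviation
  probability of a crossing tends to \<open>0\<close>, so that it eventually fits into the remaining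
  \<open>122 * \<epsilon>\<close>. The bound on the expectation is the case \<open>\<epsilon> = 1 / 500\<close>, where the length exceeds
  the threshold with probability at least one half.\<close>

section \<open>Longest increasing subsequences\<close>

lemma finite_card_image_subsets:
  assumes "finite B"
  shows "finite {card A |A. A \<subseteq> B \<and> P A}"
proof -
  have "{card A |A. A \<subseteq> B \<and> P A} \<subseteq> card ` Pow B" by auto
  then show ?thesis using assms by (meson finite_Pow_iff finite_imageI finite_subset)
qed

lemma card_le_LIS:
  assumes "finite B" "A \<subseteq> B" "mono_on A S"
  shows "card A \<le> LIS S B"
  unfolding LIS_def
  using assms by (intro Max_ge finite_card_image_subsets) auto

lemma LIS_attained:
  assumes "finite B"
  obtains A where "A \<subseteq> B" "mono_on A S" "card A = LIS S B"
proof -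
  have "mono_on {} S" by (auto intro: mono_onI)
  then have "{card A |A. A \<subseteq> B \<and> mono_on A S} \<noteq> {}" by blast
  then have "LIS S B \<in> {card A |A. A \<subseteq> B \<and> mono_on A S}"
    unfolding LIS_def using assms by (intro Max_in finite_card_image_subsets)
  then show ?thesis using that by auto
qed

lemma LIS_le_card:
  assumes "finite B" shows "LIS S B \<le> card B"
  by (rule LIS_attained[OF assms, of S]) (metis assms card_mono)

text \<open>Monotonicity in the index set, shifts of the index and changes of the sequence by a constant are
  all instances of this comparison.\<close>

lemma LIS_embed:
  assumes "finite B" "finite B'" "g ` B \<subseteq> B'" "strict_mono_on B g"
    and "\<And>a b. a \<in> B \<Longrightarrow> b \<in> B \<Longrightarrow> S a \<le> S b \<Longrightarrow> S' (g a) \<le> S' (g b)"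
  shows "LIS S B \<le> LIS S' B'"
proof -
  obtain A where A: "A \<subseteq> B" "mono_on A S" "card A = LIS S B"
    by (rule LIS_attained[OF assms(1)])
  have inj: "inj_on g A"
    using assms(4) A(1) by (meson inj_on_subset strict_mono_on_imp_inj_on)
  have "mono_on (g ` A) S'"
  proof (rule mono_onI)
    fix r s assume rs: "r \<in> g ` A" "s \<in> g ` A" "r \<le> s"
    then obtain a b where ab: "a \<in> A" "b \<in> A" "r = g a" "s = g b" by blast
    have "a \<le> b"
    proof (rule ccontr)
      assume "\<not> a \<le> b"
      then have "b < a" by simp
      then have "g b < g a" using assms(4) ab A(1) by (blast dest: strict_mono_onD)
      then show False using rs ab by simp
    qed
    then show "S' r \<le> S' s"
      using ab A assms(5)[of a b] by (auto simp: mono_on_def)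
  qed
  moreover have "g ` A \<subseteq> B'" using A(1) assms(3) by blast
  ultimately have "card (g ` A) \<le> LIS S' B'" by (intro card_le_LIS[OF assms(2)])
  then show ?thesis using A(3) inj by (simp add: card_image)
qed

text \<open>Two increasing subsequences can be chained when everything in the first block lies before and
  below everything in the second.\<close>

lemma LIS_add:
  assumes "finite B" "finite C"
    and "\<And>b c. b \<in> B \<Longrightarrow> c \<in> C \<Longrightarrow> b < c \<and> S b \<le> S c"
  shows "LIS S B + LIS S C \<le> LIS S (B \<union> C)"
proof -
  obtain A where A: "A \<subseteq> B" "mono_on A S" "card A = LIS S B"
    by (rule LIS_attained[OF assms(1)])
  obtain A' where A': "A' \<subseteq> C" "mono_on A' S" "card A' = LIS S C"
    by (rule LIS_attained[OF assms(2)])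
  have "mono_on (A \<union> A') S"
  proof (rule mono_onI)
    fix r s assume rs: "r \<in> A \<union> A'" "s \<in> A \<union> A'" "r \<le> s"
    then consider "r \<in> A" "s \<in> A" | "r \<in> A" "s \<in> A'" | "r \<in> A'" "s \<in> A" | "r \<in> A'" "s \<in> A'"
      by blast
    then show "S r \<le> S s"
    proof cases
      case 2
      then show ?thesis using assms(3)[of r s] A(1) A'(1) by blast
    next
      case 3
      then have "s < r" using assms(3) A(1) A'(1) by blast
      then show ?thesis using rs(3) by simp
    qed (use A A' assms(3) rs(3) in \<open>auto simp: mono_on_def\<close>)
  qed
  then have "card (A \<union> A') \<le> LIS S (B \<union> C)"
    using A(1) A'(1) assms(1,2) by (intro card_le_LIS) auto
  moreover have "A \<inter> A' = {}" using A(1) A'(1) assms(3) by blast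
  ultimately show ?thesis
    using A A' assms(1,2) by (metis card_Un_disjoint finite_subset)
qed

section \<open>Walks as lists of steps\<close>

definition height :: "int list \<Rightarrow> nat \<Rightarrow> int" where
  "height xs k = sum_list (take k xs)"

lemma height_simps [simp]:
  "height xs 0 = 0" "height [] k = 0" "height (a # xs) (Suc k) = a + height xs k"
  "height xs (length xs) = sum_list xs"
  by (simp_all add: height_def)

lemma height_append: "height (us @ vs) i = (if i \<le> length us then height us i else sum_list us + height vs (i - length us))"
  by (auto simp: height_def)

lemma height_append_left: "i \<le> length us \<Longrightarrow> height (us @ vs) i = height us i"
  by (simp add: height_append)

lemma height_append_right: "height (us @ vs) (length us + i) = sum_list us + height vs i"
  by (auto simp: height_append)

definition walks :: "nat \<Rightarrow> int list set" where
  "walks n = {xs. set xs \<subseteq> {1, -1} \<and> length xs = n}"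

text \<open>Sums over paths of all lengths are truncated at length \<open>n\<close>. All sums are then finite, and the
  bounds proved below do not depend on \<open>n\<close>.\<close>

definition short_walks :: "nat \<Rightarrow> int list set" where
  "short_walks n = {xs. set xs \<subseteq> {1, -1} \<and> length xs \<le> n}"

lemma finite_walks [simp]: "finite (walks n)"
  unfolding walks_def by (rule finite_lists_length_eq) simp

lemma finite_short_walks [simp]: "finite (short_walks n)"
  unfolding short_walks_def by (rule finite_lists_length_le) simp

lemma card_walks: "card (walks n) = 2 ^ n"
  unfolding walks_def by (subst card_lists_length_eq) (auto simp: numeral_2_eq_2)

lemma height_Suc_le: "set xs \<subseteq> {1, -1} \<Longrightarrow> height xs (Suc i) \<le> height xs i + 1"
proof (induction xs arbitrary: i)
  case (Cons a xs)
  then show ?case by (cases i) auto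
qed simp

text \<open>Up-steps have size at most one, so a level cannot be jumped over from below.\<close>

lemma first_passage:
  fixes f :: "nat \<Rightarrow> int"
  assumes "\<And>i. f (Suc i) \<le> f i + 1" "f 0 < c" "c \<le> f n"
  obtains k where "0 < k" "k \<le> n" "f k = c" "\<And>i. i < k \<Longrightarrow> f i < c"
proof -
  define k where "k = (LEAST i. c \<le> f i)"
  have k: "c \<le> f k" unfolding k_def using assms(3) by (rule LeastI)
  have least: "f i < c" if "i < k" for i
    using not_less_Least[of i "\<lambda>i. c \<le> f i"] that unfolding k_def by simp
  have "0 < k" using k assms(2) by (cases k) auto
  then obtain k' where "k = Suc k'" by (cases k) auto
  then have "f k = c" using k least[of k'] assms(1)[of k'] by simp
  moreover have "k \<le> n" unfolding k_def using assms(3) by (rule Least_le)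
  ultimately show ?thesis using that \<open>0 < k\<close> least by blast
qed

lemma last_passage:
  fixes f :: "nat \<Rightarrow> int"
  assumes step: "\<And>i. f (Suc i) \<le> f i + 1" and "f 0 \<le> c" "c < f n"
  obtains k where "k < n" "f k = c" "\<And>i. k < i \<Longrightarrow> i \<le> n \<Longrightarrow> c < f i"
proof -
  have "\<exists>k<n. f k = c \<and> (\<forall>i. k < i \<and> i \<le> n \<longrightarrow> c < f i)"
    using assms(3)
  proof (induction n)
    case 0 then show ?case using assms(2) by simp
  next
    case (Suc n)
    show ?case
    proof (cases "f n \<le> c")
      case True
      then have "f n = c" using Suc.prems step[of n] by simp
      then show ?thesis using Suc.prems by (intro exI[of _ n]) (auto simp: le_Suc_eq)
    next
      case False
      then obtain k where "k < n" "f k = c" "\<forall>i. k < i \<and> i \<le> n \<longrightarrow> c < f i"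
        using Suc.IH by auto
      then show ?thesis using Suc.prems by (intro exI[of _ k]) (auto simp: le_Suc_eq)
    qed
  qed
  then show ?thesis using that by blast
qed

section \<open>Path sums bounded by supersolutions\<close>

text \<open>The visits to \<open>0\<close> are counted at both ends of the path, for a path started at \<open>x\<close>. The recursion
  follows the first step, as the potential-theoretic argument does.\<close>

fun zeros :: "int \<Rightarrow> int list \<Rightarrow> nat" where
  "zeros x [] = (if x = 0 then 1 else 0)"
| "zeros x (a # xs) = (if x = 0 then 1 else 0) + zeros (x + a) xs"

lemma zeros_eq_card: "zeros x xs = card {i. i \<le> length xs \<and> x + height xs i = 0}"
proof (induction xs arbitrary: x)
  case Nil
  have "{i::nat. i \<le> 0 \<and> x = 0} = (if x = 0 then {0} else {})" by auto
  then show ?case by simp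
next
  case (Cons a xs)
  let ?A = "{i. i \<le> length xs \<and> x + a + height xs i = 0}"
  have "{i. i \<le> length (a # xs) \<and> x + height (a # xs) i = 0} = (if x = 0 then {0} else {}) \<union> Suc ` ?A"
    (is "?L = ?R")
  proof (rule set_eqI)
    fix i show "i \<in> ?L \<longleftrightarrow> i \<in> ?R" by (cases i) (auto simp: add.assoc)
  qed
  moreover have "card ((if x = 0 then {0} else {}) \<union> Suc ` ?A) = (if x = 0 then 1 else 0) + card ?A"
    by (simp add: card_image card_insert_if)
  ultimately show ?case using Cons.IH[of "x + a"] by simp
qed

definition bridges :: "int set \<Rightarrow> int \<Rightarrow> nat \<Rightarrow> int list set" where
  "bridges D x n = {xs \<in> short_walks n. (\<forall>i\<le>length xs. x + height xs i \<in> D) \<and> x + sum_list xs = 0}"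

lemma finite_bridges [simp]: "finite (bridges D x n)"
  unfolding bridges_def by simp

lemma Cons_in_bridges:
  "a # xs \<in> bridges D x (Suc n) \<longleftrightarrow> a \<in> {1, -1} \<and> x \<in> D \<and> xs \<in> bridges D (x + a) n"
proof -
  have "(\<forall>i\<le>Suc (length xs). x + height (a # xs) i \<in> D) \<longleftrightarrow>
      x \<in> D \<and> (\<forall>i\<le>length xs. x + a + height xs i \<in> D)" (is "?L \<longleftrightarrow> ?R")
  proof
    assume L: ?L
    have "x \<in> D" using L[rule_format, of 0] by simp
    moreover have "x + a + height xs i \<in> D" if "i \<le> length xs" for i
      using L[rule_format, of "Suc i"] that by (simp add: add.assoc)
    ultimately show ?R by blast
  next
    assume R: ?R
    show ?L
    proof (intro allI impI)
      fix i assume "i \<le> Suc (length xs)"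
      then show "x + height (a # xs) i \<in> D" using R by (cases i) (auto simp: add.assoc)
    qed
  qed
  then show ?thesis by (auto simp: bridges_def short_walks_def add.assoc)
qed

text \<open>The sum is the expected discounted number of arrivals at \<open>0\<close> before leaving \<open>D\<close>, with a discount
  \<open>s\<close> for each visit. Splitting off the first step yields a linear recursion in the starting point,
  so any non-negative supersolution \<open>V\<close> of that recursion dominates the sum, by induction on the
  maximal length.\<close>

lemma bridges_weight_le_supersolution:
  fixes V :: "int \<Rightarrow> real" and s :: real
  assumes V: "\<And>x. 0 \<le> V x" and s: "0 \<le> s"
    and super: "\<And>x. x \<in> D \<Longrightarrow>
      (if x = 0 then s * (1 + (V (x + 1) + V (x - 1)) / 2) else (V (x + 1) + V (x - 1)) / 2) \<le> V x"
  shows "(\<Sum>xs\<in>bridges D x n. (1/2) ^ length xs * s ^ zeros x xs) \<le> V x"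
proof (induction n arbitrary: x)
  let ?w = "\<lambda>x xs. (1/2) ^ length xs * s ^ zeros x xs"
  have w: "0 \<le> ?w x xs" for x xs using s by simp
  case 0
  show ?case
  proof (cases "x = 0 \<and> x \<in> D")
    case True
    have "sum (?w x) (bridges D x 0) \<le> sum (?w x) {[]}"
      using s by (intro sum_mono2) (auto simp: bridges_def short_walks_def)
    also have "\<dots> = s" using True by simp
    also have "\<dots> \<le> s * (1 + (V (x + 1) + V (x - 1)) / 2)"
      using s V[of "x + 1"] V[of "x - 1"] by (simp add: mult_le_cancel_left1)
    also have "\<dots> \<le> V x" using super[of x] True by auto
    finally show ?thesis .
  next
    case False
    then have "xs \<notin> bridges D x 0" for xs
      by (auto simp: bridges_def short_walks_def)
    then have "bridges D x 0 = {}" by blast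
    then show ?thesis using V by simp
  qed
next
  let ?w = "\<lambda>x xs. (1/2) ^ length xs * s ^ zeros x xs"
  have w: "0 \<le> ?w x xs" for x xs using s by simp
  case (Suc n)
  show ?case
  proof (cases "x \<in> D")
    case False
    then have "xs \<notin> bridges D x (Suc n)" for xs
      by (auto simp: bridges_def dest: spec[of _ 0])
    then have "bridges D x (Suc n) = {}" by blast
    then show ?thesis using V by simp
  next
    case True
    let ?z = "if x = 0 then s else 1" and ?E = "if x = 0 then {[]} else {}"
    let ?P = "(#) 1 ` bridges D (x + 1) n" and ?N = "(#) (-1) ` bridges D (x - 1) n"
    have sub: "bridges D x (Suc n) \<subseteq> ?E \<union> (?P \<union> ?N)"
    proof
      fix xs assume xs: "xs \<in> bridges D x (Suc n)"
      show "xs \<in> ?E \<union> (?P \<union> ?N)"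
      proof (cases xs)
        case Nil
        then show ?thesis using xs by (auto simp: bridges_def)
      next
        case (Cons a ys)
        then have "a = 1 \<or> a = -1" "ys \<in> bridges D (x + a) n"
          using xs by (auto simp: Cons_in_bridges)
        then show ?thesis using Cons by auto
      qed
    qed
    have "sum (?w x) (bridges D x (Suc n)) \<le> sum (?w x) (?E \<union> (?P \<union> ?N))"
      using w sub by (intro sum_mono2) auto
    also have "\<dots> = sum (?w x) ?E + (sum (?w x) ?P + sum (?w x) ?N)"
      by (subst sum.union_disjoint; (subst sum.union_disjoint)?) auto
    also have "sum (?w x) ?P = ?z / 2 * sum (?w (x + 1)) (bridges D (x + 1) n)"
      by (simp add: sum.reindex sum_distrib_left algebra_simps)
    also have "sum (?w x) ?N = ?z / 2 * sum (?w (x - 1)) (bridges D (x - 1) n)"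
      by (simp add: sum.reindex sum_distrib_left algebra_simps)
    also have "sum (?w x) ?E + (?z / 2 * sum (?w (x + 1)) (bridges D (x + 1) n)
        + ?z / 2 * sum (?w (x - 1)) (bridges D (x - 1) n))
      \<le> sum (?w x) ?E + (?z / 2 * V (x + 1) + ?z / 2 * V (x - 1))"
      using s Suc.IH[of "x + 1"] Suc.IH[of "x - 1"]
      by (intro add_left_mono add_mono mult_left_mono) auto
    also have "\<dots> \<le> V x" using super[OF True] by (auto simp: algebra_simps add_divide_distrib)
    finally show ?thesis .
  qed
qed

section \<open>Crossings and their decomposition at the midpoint\<close>

definition crossings :: "int \<Rightarrow> nat \<Rightarrow> int list set" where
  "crossings m n = {xs \<in> short_walks n. sum_list xs = m \<and>
     (\<forall>i. 0 < i \<and> i < length xs \<longrightarrow> 0 < height xs i \<and> height xs i < m)}"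

lemma finite_crossings [simp]: "finite (crossings m n)"
  unfolding crossings_def by simp

text \<open>The two end points are left out, so that gluing crossings never counts an index twice: the midpoint
  visits are contributed by the loop alone.\<close>

definition inner_LIS :: "int list \<Rightarrow> nat" where
  "inner_LIS xs = LIS (height xs) {0<..<length xs}"

lemma take_drop_three:
  assumes "k \<le> l" "l \<le> length xs"
  shows "xs = take k xs @ take (l - k) (drop k xs) @ drop l xs"
proof -
  have "drop l xs = drop (l - k) (drop k xs)" using assms by simp
  then show ?thesis by (metis append_take_drop_id)
qed

text \<open>The cuts are the first and the last visit to \<open>m\<close>.\<close>

lemma crossing_split:
  assumes xs: "xs \<in> crossings (2 * m) n" and m: "0 < m"
  obtains us ls vs where "us \<in> crossings m n" "ls \<in> bridges {-m<..<m} 0 n" "vs \<in> crossings m n"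
    "xs = us @ ls @ vs"
proof -
  have pm: "set xs \<subseteq> {1, -1}" and len: "length xs \<le> n" and tot: "sum_list xs = 2 * m"
    and inner: "\<And>i. 0 < i \<Longrightarrow> i < length xs \<Longrightarrow> 0 < height xs i \<and> height xs i < 2 * m"
    using xs by (auto simp: crossings_def short_walks_def)
  obtain k where k: "0 < k" "k \<le> length xs" "height xs k = m" "\<And>i. i < k \<Longrightarrow> height xs i < m"
    by (rule first_passage[of "height xs" m "length xs"]) (use height_Suc_le[OF pm] m tot in auto)
  obtain l where l: "l < length xs" "height xs l = m" "\<And>i. l < i \<Longrightarrow> i \<le> length xs \<Longrightarrow> m < height xs i"
    by (rule last_passage[of "height xs" m "length xs"]) (use height_Suc_le[OF pm] m tot in auto)
  have kl: "k \<le> l" using k l by (metis linorder_not_less order_less_irrefl)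
  define us ls vs where "us = take k xs" and "ls = take (l - k) (drop k xs)" and "vs = drop l xs"
  have split: "xs = us @ ls @ vs"
    unfolding us_def ls_def vs_def using kl l(1) by (intro take_drop_three) auto
  have lens: "length us = k" "length ls = l - k" "length vs = length xs - l"
    using k l kl by (auto simp: us_def ls_def vs_def)
  have height_us: "height xs i = height us i" if "i \<le> k" for i
    using that lens by (simp add: split height_append_left)
  have sum_us: "sum_list us = m" using height_us[of k] k(3) lens(1) height_simps(4)[of us] by simp
  have height_ls: "height xs (k + i) = m + height ls i" if "i \<le> l - k" for i
    using that lens sum_us height_append_right[of us "ls @ vs" i] by (simp add: split height_append_left)
  have sum_ls: "sum_list ls = 0"
    using height_ls[of "l - k"] kl l(2) lens(2) height_simps(4)[of ls] by simp
  have height_vs: "height xs (l + i) = m + height vs i" for i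
    using lens sum_us sum_ls kl height_append_right[of "us @ ls" vs i] by (simp add: split)
  have sw: "us \<in> short_walks n" "ls \<in> short_walks n" "vs \<in> short_walks n"
    using pm len by (simp_all add: split short_walks_def)
  have "us \<in> crossings m n"
  proof -
    have "0 < height us i \<and> height us i < m" if "0 < i" "i < length us" for i
      using k(4)[of i] inner[of i] height_us[of i] that lens(1) k(2) by simp
    then show ?thesis using sw sum_us by (simp add: crossings_def)
  qed
  moreover have "vs \<in> crossings m n"
  proof -
    have "sum_list vs = m" using tot sum_us sum_ls by (simp add: split)
    moreover have "0 < height vs i \<and> height vs i < m" if "0 < i" "i < length vs" for i
      using l(3)[of "l + i"] inner[of "l + i"] height_vs[of i] that lens by simp
    ultimately show ?thesis using sw by (simp add: crossings_def)
  qed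
  moreover have "ls \<in> bridges {-m<..<m} 0 n"
  proof -
    have "-m < height ls i \<and> height ls i < m" if "i \<le> length ls" for i
    proof -
      have "k + i < length xs" using that lens(2) l(1) kl by simp
      then show ?thesis using inner[of "k + i"] height_ls[of i] that lens(2) k(1) by simp
    qed
    then show ?thesis using sw sum_ls by (simp add: bridges_def)
  qed
  ultimately show ?thesis using that split by blast
qed

text \<open>Seen from the start of the whole path, the first crossing lies below \<open>m\<close> and the second one above
  \<open>m\<close>; all visits to the level \<open>m\<close> itself may be inserted between them.\<close>

lemma inner_LIS_concat:
  assumes us: "us \<in> crossings m n" and vs: "vs \<in> crossings m n" and m: "0 < m"
    and ls: "sum_list ls = 0"
  shows "inner_LIS us + zeros 0 ls + inner_LIS vs \<le> inner_LIS (us @ ls @ vs)"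
proof -
  let ?xs = "us @ ls @ vs"
  let ?k = "length us" and ?l = "length us + length ls"
  define U where "U = {0<..<?k}"
  define Z where "Z = (+) ?k ` {i. i \<le> length ls \<and> height ls i = 0}"
  define W where "W = (+) ?l ` {0<..<length vs}"
  have su: "sum_list us = m" and sv: "sum_list vs = m"
    and iu: "\<And>i. 0 < i \<Longrightarrow> i < length us \<Longrightarrow> height us i < m"
    and iv: "\<And>i. 0 < i \<Longrightarrow> i < length vs \<Longrightarrow> 0 < height vs i"
    using us vs by (auto simp: crossings_def)
  obtain a b where ne: "length us = Suc a" "length vs = Suc b"
    using su sv m by (cases us; cases vs) auto
  have pU: "height ?xs i = height us i" if "i \<le> ?k" for i
    using that by (simp add: height_append_left)
  have pL: "height ?xs (?k + i) = m + height ls i" if "i \<le> length ls" for i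
    using that height_append_right[of us "ls @ vs" i] su by (simp add: height_append_left)
  have pV: "height ?xs (?l + i) = m + height vs i" for i
    using su ls height_append_right[of "us @ ls" vs i] by simp
  have U: "inner_LIS us \<le> LIS (height ?xs) U"
    unfolding inner_LIS_def U_def
    by (rule LIS_embed[where g = id]) (auto simp: pU strict_mono_on_def)
  have W: "inner_LIS vs \<le> LIS (height ?xs) W"
    unfolding inner_LIS_def W_def
    by (rule LIS_embed[where g = "(+) ?l"]) (auto simp: pV strict_mono_on_def)
  have pZ: "height ?xs b = m" if "b \<in> Z" for b using that by (auto simp: Z_def pL)
  have finZ: "finite Z" unfolding Z_def by simp
  have Z: "zeros 0 ls \<le> LIS (height ?xs) Z"
  proof -
    have "card Z \<le> LIS (height ?xs) Z"
      by (rule card_le_LIS) (use finZ pZ in \<open>auto simp: mono_on_def\<close>)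
    then show ?thesis by (simp add: zeros_eq_card Z_def card_image)
  qed
  have "LIS (height ?xs) U + LIS (height ?xs) Z \<le> LIS (height ?xs) (U \<union> Z)"
    by (rule LIS_add) (use finZ pZ in \<open>auto simp: U_def pU iu less_imp_le Z_def\<close>)
  moreover have "LIS (height ?xs) (U \<union> Z) + LIS (height ?xs) W \<le> LIS (height ?xs) (U \<union> Z \<union> W)"
  proof (rule LIS_add)
    fix b c assume b: "b \<in> U \<union> Z" and c: "c \<in> W"
    have "b \<le> ?l" using b by (auto simp: U_def Z_def)
    moreover have "?l < c" using c by (auto simp: W_def)
    moreover have "height ?xs b \<le> m" using b pZ by (auto simp: U_def pU iu less_imp_le)
    moreover have "m \<le> height ?xs c"
    proof -
      obtain i where "0 < i" "i < length vs" "c = ?l + i" using c by (auto simp: W_def)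
      then show ?thesis using iv[of i] pV[of i] by simp
    qed
    ultimately show "b < c \<and> height ?xs b \<le> height ?xs c" by linarith
  qed (use finZ in \<open>auto simp: U_def W_def\<close>)
  moreover have "LIS (height ?xs) (U \<union> Z \<union> W) \<le> inner_LIS ?xs"
    unfolding inner_LIS_def
    by (rule LIS_embed[where g = id])
      (use finZ ne in \<open>auto simp: strict_mono_on_def U_def Z_def W_def\<close>)
  ultimately show ?thesis using U Z W by linarith
qed


text \<open>Each return to \<open>0\<close> before hitting \<open>\<plusminus> m\<close> has probability \<open>1 - 1 / m\<close>, so the sum is a
  geometric series in \<open>s * (1 - 1 / m)\<close> with leading term \<open>s\<close>, where \<open>s = 1 / (1 + q)\<close>. The parameter
  \<open>q\<close> is chosen to make its value simple. The supersolution is the value at \<open>0\<close> times the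
  probability \<open>1 - \<bar>x\<bar> / m\<close> of reaching \<open>0\<close> from \<open>x\<close>.\<close>

lemma loop_weight_le:
  fixes q :: real and m :: nat
  assumes m: "0 < m" and q: "0 < q"
  shows "(\<Sum>ls\<in>bridges {-int m<..<int m} 0 n. (1/2) ^ length ls * (1 / (1 + q)) ^ zeros 0 ls)
    \<le> m / (1 + m * q)"
proof -
  define C where "C = m / (1 + m * q)"
  define V :: "int \<Rightarrow> real" where "V x = C * max 0 (1 - \<bar>x\<bar> / m)" for x
  have C: "0 \<le> C" using q by (simp add: C_def)
  have denoms: "0 < 1 + m * q" "0 < 1 + q" using q m by (simp_all add: add_pos_nonneg)
  have V_in: "V x = C * (1 - \<bar>x\<bar> / m)" if "\<bar>x\<bar> \<le> int m" for x
  proof -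
    have "real_of_int \<bar>x\<bar> \<le> m" using that by linarith
    then show ?thesis using m unfolding V_def by simp
  qed
  have "(if x = 0 then 1 / (1 + q) * (1 + (V (x + 1) + V (x - 1)) / 2) else (V (x + 1) + V (x - 1)) / 2) \<le> V x"
    if x: "x \<in> {-int m<..<int m}" for x
  proof (cases "x = 0")
    case True
    have "C = 1 / (1 + q) * (1 + C * (1 - 1 / m))"
      unfolding C_def using denoms m by (simp add: divide_simps) (simp add: algebra_simps)
    then show ?thesis using True m V_in[of 0] V_in[of 1] V_in[of "-1"] by simp
  next
    case False
    have "V (x + 1) = C * (1 - \<bar>x + 1\<bar> / m)" 
    proof -
      have "\<bar>x + 1\<bar> \<le> int m" using x by auto
      then show ?thesis using V_in[of "x + 1"] by simp
    qed
    moreover have "V (x - 1) = C * (1 - \<bar>x - 1\<bar> / m)" 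
    proof -
      have "\<bar>x - 1\<bar> \<le> int m" using x by auto
      then show ?thesis using V_in[of "x - 1"] by simp
    qed
    moreover have "V x = C * (1 - \<bar>x\<bar> / m)" using V_in[of x] x by (auto simp: abs_le_iff)
    moreover have "real_of_int \<bar>x + 1\<bar> + real_of_int \<bar>x - 1\<bar> = 2 * real_of_int \<bar>x\<bar>"
      using False by linarith
    moreover have "(C * (1 - a / m) + C * (1 - b / m)) / 2 = C * (1 - c / m)" if "a + b = 2 * c" for a b c :: real
    proof -
      have "C * (1 - a / m) + C * (1 - b / m) = C * (2 - (a + b) / m)"
        by (simp add: algebra_simps add_divide_distrib)
      then show ?thesis unfolding that by (simp only:) (simp add: right_diff_distrib diff_divide_distrib)
    qed
    ultimately have "(V (x + 1) + V (x - 1)) / 2 = V x" by simp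
    then show ?thesis using False by simp
  qed
  then have "(\<Sum>ls\<in>bridges {-int m<..<int m} 0 n. (1/2) ^ length ls * (1 / (1 + q)) ^ zeros 0 ls) \<le> V 0"
    using C q by (intro bridges_weight_le_supersolution) (auto simp: V_def)
  then show ?thesis using m by (simp add: V_def C_def)
qed

text \<open>The expected number of visits to \<open>0\<close> before hitting \<open>N\<close>: one leaves \<open>0\<close> for \<open>N\<close> without
  return with probability \<open>1 / (2 * N)\<close>. The supersolution is the Green function.\<close>

lemma green_weight_le:
  "(\<Sum>as\<in>bridges {..<int N} 0 n. (1/2) ^ length as) \<le> 2 * real N"
proof -
  define V :: "int \<Rightarrow> real" where "V x = 2 * max 0 (min (int N) (int N - x))" for x
  have "(if x = 0 then 1 * (1 + (V (x + 1) + V (x - 1)) / 2) else (V (x + 1) + V (x - 1)) / 2) \<le> V x"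
    if x: "x \<in> {..<int N}" for x
  proof -
    \<comment> \<open>The Green function is constant below \<open>0\<close> and linear between \<open>0\<close> and \<open>N\<close>, with a concave
      kink at \<open>0\<close> of exactly the size of the source term.\<close>
    have V_eq: "V y = 2 * (if y \<le> 0 then int N else int N - y)" if "y \<le> int N" for y :: int
      using that by (auto simp: V_def)
    show ?thesis
    proof (cases "x = 0")
      case True
      then show ?thesis using V_eq[of 0] V_eq[of 1] V_eq[of "-1"] x by (simp add: field_simps)
    next
      case False
      then show ?thesis using V_eq[of "x + 1"] V_eq[of "x - 1"] V_eq[of x] x by (auto split: if_splits)
    qed
  qed
  then have "(\<Sum>as\<in>bridges {..<int N} 0 n. (1/2) ^ length as * 1 ^ zeros 0 as) \<le> V 0"
    by (intro bridges_weight_le_supersolution) (auto simp: V_def)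
  then show ?thesis by (simp add: V_def)
qed

section \<open>The Laplace transform of the subsequence length of a crossing\<close>

definition crossing_gf :: "real \<Rightarrow> int \<Rightarrow> nat \<Rightarrow> real" where
  "crossing_gf s m n = (\<Sum>xs\<in>crossings m n. (1/2) ^ length xs * s ^ inner_LIS xs)"

lemma crossing_gf_nonneg: "0 \<le> s \<Longrightarrow> 0 \<le> crossing_gf s m n"
  unfolding crossing_gf_def by (intro sum_nonneg) simp

text \<open>The generating function turns the decomposition at the midpoint into a product: two crossings
  of \<open>m\<close> and one loop.\<close>

lemma crossing_gf_double:
  fixes q :: real and m :: nat
  assumes m: "0 < m" and q: "0 < q"
  defines "s \<equiv> 1 / (1 + q)"
  shows "crossing_gf s (2 * int m) n \<le> (crossing_gf s (int m) n)\<^sup>2 * (m / (1 + m * q))"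
proof -
  have s: "0 \<le> s" "s \<le> 1" using q by (simp_all add: s_def)
  define w where "w xs = (1/2) ^ length xs * s ^ inner_LIS xs" for xs
  define v where "v ls = (1/2) ^ length ls * s ^ zeros 0 ls" for ls
  define K where "K = crossings (int m) n"
  define T where "T = K \<times> bridges {-int m<..<int m} 0 n \<times> K"
  define glue :: "int list \<times> int list \<times> int list \<Rightarrow> int list"
    where "glue = (\<lambda>(us, ls, vs). us @ ls @ vs)"
  have fin: "finite T" by (simp add: T_def K_def)
  have "crossings (2 * int m) n \<subseteq> glue ` T"
  proof
    fix xs assume "xs \<in> crossings (2 * int m) n"
    then obtain us ls vs where "us \<in> K" "ls \<in> bridges {-int m<..<int m} 0 n" "vs \<in> K" "xs = us @ ls @ vs"
      using m unfolding K_def by (elim crossing_split) auto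
    then show "xs \<in> glue ` T" by (intro image_eqI[of _ _ "(us, ls, vs)"]) (auto simp: glue_def T_def)
  qed
  then have "crossing_gf s (2 * int m) n \<le> sum w (glue ` T)"
    unfolding crossing_gf_def w_def using fin s by (intro sum_mono2) auto
  also have "\<dots> \<le> sum (w \<circ> glue) T"
    using fin s by (intro sum_image_le) (auto simp: w_def)
  also have "\<dots> \<le> (\<Sum>(us, ls, vs)\<in>T. w us * (v ls * w vs))"
  proof (rule sum_mono, clarify)
    fix us ls vs assume "(us, ls, vs) \<in> T"
    then have "inner_LIS us + zeros 0 ls + inner_LIS vs \<le> inner_LIS (us @ ls @ vs)"
      using m by (intro inner_LIS_concat[of _ "int m" n]) (auto simp: T_def K_def bridges_def)
    then have "s ^ inner_LIS (us @ ls @ vs) \<le> s ^ (inner_LIS us + zeros 0 ls + inner_LIS vs)"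
      using s by (intro power_decreasing) auto
    then have "w (us @ ls @ vs) \<le> (1/2) ^ length (us @ ls @ vs) * s ^ (inner_LIS us + zeros 0 ls + inner_LIS vs)"
      unfolding w_def by (intro mult_left_mono) auto
    also have "\<dots> = w us * (v ls * w vs)" by (simp add: w_def v_def power_add)
    finally show "(w \<circ> glue) (us, ls, vs) \<le> w us * (v ls * w vs)" by (simp add: glue_def)
  qed
  also have "\<dots> = sum w K * (sum v (bridges {-int m<..<int m} 0 n) * sum w K)"
    unfolding T_def by (simp add: sum_product sum.cartesian_product case_prod_unfold)
  also have "\<dots> = (crossing_gf s (int m) n)\<^sup>2 * sum v (bridges {-int m<..<int m} 0 n)"
    by (simp add: crossing_gf_def w_def K_def power2_eq_square)
  also have "\<dots> \<le> (crossing_gf s (int m) n)\<^sup>2 * (m / (1 + m * q))"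
    unfolding v_def s_def by (intro mult_left_mono loop_weight_le m q) simp
  finally show ?thesis .
qed

lemma crossings_1: "crossings 1 n \<subseteq> {[1]}"
proof
  fix xs assume xs: "xs \<in> crossings 1 n"
  have "\<not> 1 < length xs"
  proof
    assume "1 < length xs"
    then have "0 < height xs 1 \<and> height xs 1 < 1" using xs unfolding crossings_def by blast
    then show False by linarith
  qed
  then have "length xs = 0 \<or> length xs = 1" by linarith
  then show "xs \<in> {[1]}" using xs by (auto simp: crossings_def length_Suc_conv)
qed

lemma one_plus_ge_exp_half:
  fixes y :: real
  assumes "0 \<le> y" "y \<le> 1"
  shows "exp (y / 2) \<le> 1 + y"
proof -
  have "exp (y / 2) \<le> 1 + y / 2 + (y / 2)\<^sup>2" using assms by (intro exp_bound) auto
  also have "(y / 2)\<^sup>2 \<le> y / 2" using assms mult_left_mono[of y 1 y] by (simp add: power2_eq_square)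
  finally show ?thesis by simp
qed

text \<open>Up to the factor \<open>1 / (2 * 2 ^ j)\<close>, the total weight of the crossings, this bounds the Laplace
  transform. Squaring doubles the exponent, and the loop contributes the factor
  \<open>1 / (1 + 2 ^ j * q) \<le> exp (- (2 ^ j * q / 2))\<close>, which is where one more multiple of
  \<open>2 ^ Suc j * q / 4\<close> comes from at each doubling.\<close>

lemma crossing_gf_le:
  fixes q :: real
  assumes q: "0 < q" and j: "2 ^ j * q \<le> 1"
  shows "crossing_gf (1 / (1 + q)) (2 ^ j) n \<le> exp (- (j * 2 ^ j * q / 4)) / (2 * 2 ^ j)"
  using j
proof (induction j)
  case 0
  have "crossing_gf (1 / (1 + q)) 1 n \<le> (\<Sum>xs\<in>{[1]}. (1/2) ^ length xs * (1 / (1 + q)) ^ inner_LIS xs)"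
    unfolding crossing_gf_def using q by (intro sum_mono2 crossings_1) auto
  also have "inner_LIS [1] = 0"
    using LIS_le_card[of "{0<..<1}" "height [1]"] by (simp add: inner_LIS_def)
  then have "(\<Sum>xs\<in>{[1]}. (1/2) ^ length xs * (1 / (1 + q)) ^ inner_LIS xs) = 1/2" by simp
  finally show ?case by simp
next
  case (Suc j)
  define y where "y = 2 ^ j * q"
  have y: "0 \<le> y" "y \<le> 1" using Suc.prems q by (auto simp: y_def)
  let ?G = "crossing_gf (1 / (1 + q)) (2 ^ j) n"
  have "crossing_gf (1 / (1 + q)) (2 ^ Suc j) n \<le> ?G\<^sup>2 * (2 ^ j / (1 + y))"
    using crossing_gf_double[of "2 ^ j" q n] q by (simp add: y_def)
  also have "\<dots> \<le> (exp (- (j * 2 ^ j * q / 4)) / (2 * 2 ^ j))\<^sup>2 * (2 ^ j * exp (- (y / 2)))"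
  proof (intro mult_mono power_mono)
    show "?G \<le> exp (- (j * 2 ^ j * q / 4)) / (2 * 2 ^ j)"
      using Suc y by (simp add: y_def)
    show "0 \<le> ?G" using q by (simp add: crossing_gf_nonneg)
    have "1 / (1 + y) \<le> 1 / exp (y / 2)"
      using one_plus_ge_exp_half[OF y] y by (intro divide_left_mono) (auto intro: mult_pos_pos)
    then show "2 ^ j / (1 + y) \<le> 2 ^ j * exp (- (y / 2))"
      using mult_left_mono[of "1 / (1 + y)" "exp (- (y / 2))" "2 ^ j"] by (simp add: exp_minus inverse_eq_divide)
  qed (use y in auto)
  also have "\<dots> = exp (- (j * 2 ^ j * q / 4) + - (j * 2 ^ j * q / 4) + - (y / 2)) / (2 * 2 ^ Suc j)"
    by (simp only: exp_add) (simp add: power2_eq_square)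
  also have "- (j * 2 ^ j * q / 4) + - (j * 2 ^ j * q / 4) + - (y / 2) = - (real (Suc j) * 2 ^ Suc j * q / 4)"
    by (simp add: y_def algebra_simps add_divide_distrib)
  finally show ?case .
qed


section \<open>Walks that stay below a level\<close>

definition staying_below :: "int \<Rightarrow> nat \<Rightarrow> int list set" where
  "staying_below y k = {xs \<in> walks k. \<forall>i\<le>k. height xs i < y}"

lemma card_staying_below_Suc:
  "card (staying_below y (Suc k)) \<le> card (staying_below (y - 1) k) + card (staying_below (y + 1) k)"
proof -
  have "staying_below y (Suc k) \<subseteq> (#) 1 ` staying_below (y - 1) k \<union> (#) (-1) ` staying_below (y + 1) k"
  proof
    fix xs assume xs: "xs \<in> staying_below y (Suc k)"
    then obtain a ys where ys: "xs = a # ys" "a = 1 \<or> a = -1" "ys \<in> walks k"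
      by (cases xs) (auto simp: staying_below_def walks_def)
    have "a + height ys i < y" if "i \<le> k" for i
      using xs that ys(1) unfolding staying_below_def by (auto dest: spec[of _ "Suc i"])
    then have "ys \<in> staying_below (y - a) k"
      using ys(3) by (auto simp: staying_below_def algebra_simps)
    then show "xs \<in> (#) 1 ` staying_below (y - 1) k \<union> (#) (-1) ` staying_below (y + 1) k"
      using ys by auto
  qed
  then have "card (staying_below y (Suc k)) \<le>
      card ((#) 1 ` staying_below (y - 1) k \<union> (#) (-1) ` staying_below (y + 1) k)"
    by (intro card_mono) (auto simp: staying_below_def)
  also have "\<dots> \<le> card ((#) (1::int) ` staying_below (y - 1) k) + card ((#) (-1::int) ` staying_below (y + 1) k)"
    by (rule card_Un_le)
  finally show ?thesis by (simp add: card_image)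
qed

text \<open>The distance to the level is a random walk started at \<open>y\<close>. If it has not hit \<open>0\<close> in \<open>k\<close> steps, it has
  either hit \<open>l\<close> first, with probability \<open>y / l\<close>, or stayed inside the interval for \<open>k\<close> steps. The expected exit
  time is \<open>y * (l - y)\<close>, so Markov's inequality bounds the second probability by \<open>y * (l - y) / k\<close>.
  The sum of both bounds is verified directly by induction on \<open>k\<close>; when \<open>y * (l - y)\<close> exceeds \<open>k\<close>
  it is trivial.\<close>

lemma staying_below_fraction_le:
  fixes y l :: int
  assumes "0 \<le> y" "y \<le> l"
  shows "k * (card (staying_below y k) / 2 ^ k) \<le> k * (y / l) + y * (l - y)"
  using assms
proof (induction k arbitrary: y)
  case 0
  then show ?case by simp
next
  case (Suc k)
  let ?u = "\<lambda>y k. real (card (staying_below y k)) / 2 ^ k"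
  have u1: "?u y k \<le> 1" for y k
  proof -
    have "card (staying_below y k) \<le> card (walks k)"
      by (intro card_mono) (auto simp: staying_below_def)
    then have "real (card (staying_below y k)) \<le> 2 ^ k" by (simp add: card_walks)
    then show ?thesis by simp
  qed
  consider "y = 0" | "y = l" "0 < y" | "0 < y" "y < l" "Suc k \<le> y * (l - y)"
    | "0 < y" "y < l" "y * (l - y) \<le> k"
    using Suc.prems by linarith
  then show ?case
  proof cases
    case 1
    have "staying_below 0 (Suc k) = {}" by (auto simp: staying_below_def)
    then show ?thesis using 1 by simp
  next
    case 2
    then show ?thesis using mult_left_mono[OF u1[of y "Suc k"], of "real (Suc k)"] by simp
  next
    case 3
    have "Suc k * ?u y (Suc k) \<le> Suc k" using mult_left_mono[OF u1[of y "Suc k"], of "real (Suc k)"] by simp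
    also have "\<dots> \<le> y * (l - y)" using 3(3) by linarith
    also have "\<dots> \<le> Suc k * (y / l) + y * (l - y)" using Suc.prems by simp
    finally show ?thesis by simp
  next
    case 4
    \<comment> \<open>An integer that is positive and at most \<open>k\<close>: the induction hypothesis can be divided by \<open>k\<close>.\<close>
    have "0 < y * (l - y)" using 4 by simp
    then have k: "0 < real k" using 4(3) by linarith
    have average: "a \<le> (B + D) / 2" if "a \<le> (b + c) / 2" "b \<le> B" "c \<le> D" for a b c B D :: real
      using that by (meson add_mono divide_right_mono order_trans zero_le_numeral)
    \<comment> \<open>One step changes \<open>y * (l - y)\<close> by \<open>-1\<close> on average and leaves \<open>y / l\<close> unchanged.\<close>
    have "?u y (Suc k) \<le> (?u (y - 1) k + ?u (y + 1) k) / 2"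
    proof -
      have "real (card (staying_below y (Suc k))) \<le> card (staying_below (y - 1) k) + card (staying_below (y + 1) k)"
        using card_staying_below_Suc[of y k] by linarith
      then show ?thesis by (simp add: field_simps)
    qed
    then have "k * ?u y (Suc k) \<le> (k * ?u (y - 1) k + k * ?u (y + 1) k) / 2"
      using k mult_left_mono[of "?u y (Suc k)" "(?u (y - 1) k + ?u (y + 1) k) / 2" "real k"]
      by (simp add: algebra_simps)
    moreover have "k * ?u (y - 1) k \<le> k * ((y - 1) / l) + (y - 1) * (l - (y - 1))"
      using Suc.IH[of "y - 1"] 4 by simp
    moreover have "k * ?u (y + 1) k \<le> k * ((y + 1) / l) + (y + 1) * (l - (y + 1))"
      using Suc.IH[of "y + 1"] 4 by simp
    ultimately have "k * ?u y (Suc k) \<le> (k * ((y - 1) / l) + (y - 1) * (l - (y - 1)) + (k * ((y + 1) / l) + (y + 1) * (l - (y + 1)))) / 2"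
      by (rule average)
    also have "\<dots> = k * (y / l) + (y * (l - y) - 1)"
      by (simp add: field_simps diff_divide_distrib add_divide_distrib)
    finally have "?u y (Suc k) \<le> y / l + (y * (l - y) - 1) / k"
      using k by (simp add: field_simps)
    then have "Suc k * ?u y (Suc k) \<le> Suc k * (y / l + (y * (l - y) - 1) / k)"
      by (intro mult_left_mono) auto
    also have "\<dots> = Suc k * (y / l) + Suc k * ((y * (l - y) - 1) / k)" by (rule distrib_left)
    also have "Suc k * ((y * (l - y) - 1) / k) \<le> y * (l - y)"
    proof -
      define A where "A = real_of_int (y * (l - y))"
      have "A \<le> k" using 4(3) unfolding A_def by linarith
      then have "Suc k * (A - 1) / k \<le> A" using k by (simp add: divide_simps algebra_simps)
      then show ?thesis by (simp add: A_def)
    qed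
    finally show ?thesis by simp
  qed
qed

text \<open>The two error terms \<open>N / l\<close> and \<open>N * (l - N) / n\<close> balance when \<open>l - N\<close> is about \<open>sqrt n\<close>.\<close>

lemma staying_below_fraction_le_sqrt:
  assumes N: "0 < N" and n: "0 < n"
  shows "card (staying_below (int N) n) / 2 ^ n \<le> 2 * N / sqrt n"
proof -
  define a where "a = nat \<lfloor>sqrt n\<rfloor>"
  have a: "real a \<le> sqrt n" "sqrt n < real a + 1"
    unfolding a_def by (simp_all add: of_nat_nat)
  define l where "l = int N + int a"
  have l: "sqrt n \<le> l" using a N by (simp add: l_def)
  have sq: "0 < sqrt n" using n by simp
  have "n * (card (staying_below (int N) n) / 2 ^ n) \<le> n * (int N / l) + int N * (l - int N)"
    by (rule staying_below_fraction_le) (auto simp: l_def)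
  also have "\<dots> \<le> n * (N / sqrt n) + N * sqrt n"
  proof -
    have "real N / l \<le> N / sqrt n" using l sq less_le_trans[OF sq l] by (intro divide_left_mono mult_pos_pos) auto
    moreover have "real_of_int (int N * (l - int N)) \<le> N * sqrt n"
      using a(1) by (simp add: l_def mult_left_mono)
    ultimately show ?thesis by (intro add_mono mult_left_mono) auto
  qed
  also have "\<dots> = n * (2 * N / sqrt n)"
    using sq real_sqrt_mult_self[of n] by (simp add: field_simps)
  finally show ?thesis using n by (simp only: mult_le_cancel_left_pos of_nat_0_less_iff)
qed

section \<open>Walks with short increasing subsequences are rare\<close>

text \<open>The cuts are the first visit to \<open>N\<close> and the last visit to \<open>0\<close> before it.\<close>

lemma hitting_split:
  assumes xs: "xs \<in> walks n" and N: "0 < N" and i: "i \<le> n" "N \<le> height xs i"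
  obtains as cs bs where "as \<in> bridges {..<N} 0 n" "cs \<in> crossings N n"
    "length as + length cs \<le> n" "bs \<in> walks (n - length as - length cs)" "xs = as @ cs @ bs"
proof -
  have pm: "set xs \<subseteq> {1, -1}" and len: "length xs = n"
    using xs by (auto simp: walks_def)
  obtain t where t: "0 < t" "t \<le> i" "height xs t = N" "\<And>i. i < t \<Longrightarrow> height xs i < N"
    by (rule first_passage[of "height xs" N i]) (use height_Suc_le[OF pm] i N in auto)
  obtain k where k: "k < t" "height xs k = 0" "\<And>i. k < i \<Longrightarrow> i \<le> t \<Longrightarrow> 0 < height xs i"
    by (rule last_passage[of "height xs" 0 t]) (use height_Suc_le[OF pm] t N in auto)
  define as cs bs where "as = take k xs" and "cs = take (t - k) (drop k xs)" and "bs = drop t xs"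
  have split: "xs = as @ cs @ bs"
    unfolding as_def cs_def bs_def using k(1) t(2) i len by (intro take_drop_three) auto
  have lens: "length as = k" "length cs = t - k" "length bs = n - t"
    using k(1) t(2) i len by (auto simp: as_def cs_def bs_def)
  have height_as: "height xs i = height as i" if "i \<le> k" for i
    using that lens by (simp add: split height_append_left)
  have sum_as: "sum_list as = 0"
    using height_as[of k] k(2) lens(1) height_simps(4)[of as] by simp
  have height_cs: "height xs (k + i) = height cs i" if "i \<le> t - k" for i
    using that lens sum_as height_append_right[of as "cs @ bs" i] by (simp add: split height_append_left)
  have sum_cs: "sum_list cs = N"
    using height_cs[of "t - k"] k(1) t(3) lens(2) height_simps(4)[of cs] by simp
  have sw: "as \<in> short_walks n" "cs \<in> short_walks n" "bs \<in> walks (n - length as - length cs)"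
    using pm len lens k(1) by (simp_all add: split short_walks_def walks_def)
  have "as \<in> bridges {..<N} 0 n"
  proof -
    have "height as i < N" if "i \<le> length as" for i
      using t(4)[of i] height_as[of i] that k(1) lens(1) by simp
    then show ?thesis using sw sum_as by (simp add: bridges_def)
  qed
  moreover have "cs \<in> crossings N n"
  proof -
    have "0 < height cs i \<and> height cs i < N" if "0 < i" "i < length cs" for i
      using k(3)[of "k + i"] t(4)[of "k + i"] height_cs[of i] that lens(2) by simp
    then show ?thesis using sw sum_cs by (simp add: crossings_def)
  qed
  moreover have "length as + length cs \<le> n" using lens k(1) t(2) i(1) by simp
  ultimately show ?thesis using that sw(3) split by blast
qed

lemma inner_LIS_le_LIS_factor:
  assumes "sum_list as = 0"
  shows "inner_LIS cs \<le> LIS (height (as @ cs @ bs)) {0..<length (as @ cs @ bs)}"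
  unfolding inner_LIS_def
  by (rule LIS_embed[where g = "(+) (length as)"])
    (auto simp: strict_mono_on_def height_append_right height_append_left)

text \<open>A union bound over the position of the crossing. Summing over the paths before the crossing
  costs \<open>2 * N\<close>, the expected number of visits to \<open>0\<close>, which the total weight \<open>1 / (2 * N)\<close> of
  the crossings compensates. What remains is the exponential Markov inequality at the parameter
  \<open>q = 1 / 2 ^ J\<close>, the largest one admitted by \<open>crossing_gf_le\<close>.\<close>

lemma hitting_small_LIS_fraction_le:
  fixes x :: real
  shows "card {xs \<in> walks n. (\<exists>i\<le>n. 2 ^ J \<le> height xs i) \<and> LIS (height xs) {0..<n} < x} / 2 ^ n
    \<le> exp (x / 2 ^ J - J / 4)"
proof -
  define N :: nat where "N = 2 ^ J"
  define q :: real where "q = 1 / 2 ^ J"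
  define s where "s = 1 / (1 + q)"
  have q: "0 < q" by (simp add: q_def)
  have s: "0 \<le> s" using q by (simp add: s_def)
  define w :: "int list \<Rightarrow> real" where "w xs = (1/2) ^ length xs" for xs
  define B where "B = {xs \<in> walks n. (\<exists>i\<le>n. 2 ^ J \<le> height xs i) \<and> LIS (height xs) {0..<n} < x}"
  \<comment> \<open>\<open>I\<close> lists the possible pairs of a path to the start of the crossing and the crossing itself;
    \<open>F\<close> is the cylinder of all walks that begin with such a pair.\<close>
  define I where "I = {(as, cs). as \<in> bridges {..<int N} 0 n \<and> cs \<in> crossings (int N) n \<and>
    length as + length cs \<le> n \<and> inner_LIS cs < x}"
  define F where "F = (\<lambda>(as, cs). (\<lambda>bs::int list. as @ cs @ bs) ` walks (n - length as - length cs))"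
  have I_sub: "I \<subseteq> bridges {..<int N} 0 n \<times> {cs \<in> crossings (int N) n. inner_LIS cs < x}"
    by (auto simp: I_def)
  have finI: "finite I" by (rule finite_subset[OF I_sub]) simp
  have "B \<subseteq> (\<Union>p\<in>I. F p)"
  proof
    fix xs assume "xs \<in> B"
    then obtain i where i: "xs \<in> walks n" "i \<le> n" "int N \<le> height xs i" "LIS (height xs) {0..<n} < x"
      by (auto simp: B_def N_def)
    obtain as cs bs where split: "as \<in> bridges {..<int N} 0 n" "cs \<in> crossings (int N) n"
      "length as + length cs \<le> n" "bs \<in> walks (n - length as - length cs)" "xs = as @ cs @ bs"
      by (rule hitting_split[OF i(1) _ i(2,3)]) (simp add: N_def)
    have "inner_LIS cs \<le> LIS (height xs) {0..<n}"
      using inner_LIS_le_LIS_factor[of as cs bs] split i(1) by (auto simp: bridges_def walks_def)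
    then have "inner_LIS cs < x" using i(4) by linarith
    then have "(as, cs) \<in> I" using split by (simp add: I_def)
    moreover have "xs \<in> F (as, cs)" using split by (auto simp: F_def)
    ultimately show "xs \<in> (\<Union>p\<in>I. F p)" by blast
  qed
  then have "card B \<le> card (\<Union>p\<in>I. F p)" using finI by (intro card_mono) (auto simp: F_def)
  also have "\<dots> \<le> (\<Sum>p\<in>I. card (F p))" by (rule card_UN_le[OF finI])
  finally have "card B / 2 ^ n \<le> (\<Sum>p\<in>I. card (F p) / 2 ^ n)"
    by (simp add: sum_divide_distrib[symmetric] divide_right_mono flip: of_nat_sum)
  also have "\<dots> \<le> (\<Sum>(as, cs)\<in>I. w as * w cs)"
  proof (rule sum_mono, clarify)
    fix as cs assume p: "(as, cs) \<in> I"
    have "card (F (as, cs)) \<le> card (walks (n - length as - length cs))"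
      unfolding F_def by (simp add: card_image_le)
    then have "real (card (F (as, cs))) \<le> 2 ^ (n - length as - length cs)"
      by (simp add: card_walks)
    then have "real (card (F (as, cs))) / 2 ^ n \<le> 2 ^ (n - length as - length cs) / 2 ^ n"
      by (intro divide_right_mono) simp_all
    also have "\<dots> = w as * w cs"
    proof -
      have "n = (n - length as - length cs) + (length as + length cs)" using p by (simp add: I_def)
      then have "(2::real) ^ n = 2 ^ (n - length as - length cs) * (2 ^ length as * 2 ^ length cs)"
        by (metis power_add)
      then show ?thesis by (simp add: w_def power_one_over)
    qed
    finally show "real (card (F (as, cs))) / 2 ^ n \<le> w as * w cs" .
  qed
  also have "\<dots> \<le> (\<Sum>(as, cs)\<in>bridges {..<int N} 0 n \<times> {cs \<in> crossings (int N) n. inner_LIS cs < x}. w as * w cs)"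
    by (rule sum_mono2[OF _ I_sub]) (auto simp: w_def)
  also have "\<dots> = sum w (bridges {..<int N} 0 n) * sum w {cs \<in> crossings (int N) n. inner_LIS cs < x}"
    by (simp add: sum_product sum.cartesian_product)
  also have "\<dots> \<le> (2 * N) * (exp (x * q) * crossing_gf s (int N) n)"
  proof (rule mult_mono)
    show "sum w (bridges {..<int N} 0 n) \<le> 2 * N" unfolding w_def using green_weight_le[of N n] by simp
    have "sum w {cs \<in> crossings (int N) n. inner_LIS cs < x} \<le>
        (\<Sum>cs\<in>{cs \<in> crossings (int N) n. inner_LIS cs < x}. exp (x * q) * (w cs * s ^ inner_LIS cs))"
    proof (rule sum_mono)
      fix cs assume "cs \<in> {cs \<in> crossings (int N) n. inner_LIS cs < x}"
      then have small: "inner_LIS cs \<le> x" by simp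
      have "exp (- q) \<le> s"
        using exp_ge_add_one_self[of q] q by (simp add: s_def exp_minus inverse_eq_divide divide_left_mono)
      then have "exp (- q) ^ inner_LIS cs \<le> s ^ inner_LIS cs" by (intro power_mono) auto
      then have "exp (- (inner_LIS cs * q)) \<le> s ^ inner_LIS cs"
        by (simp add: exp_of_nat_mult[symmetric])
      then have "exp (x * q) * exp (- (inner_LIS cs * q)) \<le> exp (x * q) * s ^ inner_LIS cs"
        by (intro mult_left_mono) auto
      moreover have "1 \<le> exp (x * q) * exp (- (inner_LIS cs * q))"
        using small q by (simp add: exp_add[symmetric] mult_right_mono)
      ultimately have "1 \<le> exp (x * q) * s ^ inner_LIS cs" by (rule order_trans[rotated])
      then show "w cs \<le> exp (x * q) * (w cs * s ^ inner_LIS cs)"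
        using mult_left_mono[of 1 "exp (x * q) * s ^ inner_LIS cs" "w cs"] by (simp add: w_def mult_ac)
    qed
    also have "\<dots> \<le> (\<Sum>cs\<in>crossings (int N) n. exp (x * q) * (w cs * s ^ inner_LIS cs))"
      using s by (intro sum_mono2) (auto simp: w_def)
    finally show "sum w {cs \<in> crossings (int N) n. inner_LIS cs < x} \<le> exp (x * q) * crossing_gf s (int N) n"
      by (simp add: crossing_gf_def w_def sum_distrib_left)
  qed (auto intro!: sum_nonneg simp: w_def)
  also have "\<dots> \<le> (2 * N) * (exp (x * q) * (exp (- (J / 4)) / (2 * N)))"
    using crossing_gf_le[of q J n] q
    by (intro mult_left_mono) (auto simp: N_def q_def s_def)
  also have "\<dots> = exp (x / 2 ^ J - J / 4)"
    by (simp add: N_def q_def exp_add[symmetric])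
  finally show ?thesis by (simp add: B_def)
qed

lemma small_LIS_fraction_le:
  fixes x :: real
  assumes n: "0 < n"
  shows "card {xs \<in> walks n. LIS (height xs) {0..<n} < x} / 2 ^ n
    \<le> 2 * 2 ^ J / sqrt n + exp (x / 2 ^ J - J / 4)"
proof -
  let ?B = "{xs \<in> walks n. (\<exists>i\<le>n. 2 ^ J \<le> height xs i) \<and> LIS (height xs) {0..<n} < x}"
  have "{xs \<in> walks n. LIS (height xs) {0..<n} < x} \<subseteq> staying_below (2 ^ J) n \<union> ?B"
    by (auto simp: staying_below_def not_less)
  then have "card {xs \<in> walks n. LIS (height xs) {0..<n} < x} \<le> card (staying_below (2 ^ J) n \<union> ?B)"
    by (intro card_mono) (auto simp: staying_below_def)
  also have "\<dots> \<le> card (staying_below (2 ^ J) n) + card ?B" by (rule card_Un_le)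
  finally have "card {xs \<in> walks n. LIS (height xs) {0..<n} < x} / 2 ^ n
      \<le> card (staying_below (2 ^ J) n) / 2 ^ n + card ?B / 2 ^ n"
    by (simp add: add_divide_distrib[symmetric] divide_right_mono flip: of_nat_add)
  also have "\<dots> \<le> 2 * 2 ^ J / sqrt n + exp (x / 2 ^ J - J / 4)"
    using staying_below_fraction_le_sqrt[of "2 ^ J" n] n
    by (intro add_mono hitting_small_LIS_fraction_le) simp
  finally show ?thesis .
qed


section \<open>From lists of steps to the random walk\<close>

context simple_random_walk
begin

definition steps_upto :: "nat \<Rightarrow> 'a \<Rightarrow> int list" where
  "steps_upto n \<omega> = map (\<lambda>i. X (Suc i) \<omega>) [0..<n]"

lemma length_steps_upto [simp]: "length (steps_upto n \<omega>) = n"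
  by (simp add: steps_upto_def)

lemma height_steps_upto: "k \<le> n \<Longrightarrow> height (steps_upto n \<omega>) k = walk X k \<omega>"
proof -
  assume "k \<le> n"
  then have "height (steps_upto n \<omega>) k = (\<Sum>i<k. X (Suc i) \<omega>)"
    by (simp add: height_def steps_upto_def take_map min_def interv_sum_list_conv_sum_set_nat
        atLeast0LessThan)
  also have "\<dots> = walk X k \<omega>"
    unfolding walk_def by (rule sum.reindex_bij_witness[of _ "\<lambda>i. i - 1" Suc]) auto
  finally show ?thesis .
qed

lemma LIS_walk_eq: "LIS (\<lambda>k. walk X k \<omega>) {0..<n} = LIS (height (steps_upto n \<omega>)) {0..<n}"
proof (rule antisym)
  let ?S = "\<lambda>k. walk X k \<omega>" and ?S' = "height (steps_upto n \<omega>)"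
  have eq: "?S' k = ?S k" if "k \<in> {0..<n}" for k using that by (simp add: height_steps_upto)
  show "LIS ?S {0..<n} \<le> LIS ?S' {0..<n}"
    by (rule LIS_embed[where g = "\<lambda>k. k"]) (simp_all add: eq strict_mono_on_def)
  show "LIS ?S' {0..<n} \<le> LIS ?S {0..<n}"
    by (rule LIS_embed[where g = "\<lambda>k. k"]) (simp_all add: eq strict_mono_on_def)
qed

lemma measurable_X: "1 \<le> i \<Longrightarrow> X i \<in> measurable M (count_space UNIV)"
  using indep_steps by (simp add: indep_vars_def)

lemma steps_upto_eq_iff:
  "steps_upto n \<omega> = xs \<longleftrightarrow> length xs = n \<and> (\<forall>i<n. X (Suc i) \<omega> = xs ! i)"
  by (auto simp: steps_upto_def list_eq_iff_nth_eq)

lemma measurable_steps_upto: "steps_upto n \<in> measurable M (count_space UNIV)"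
proof (subst measurable_count_space_eq_countable)
  show "countable (UNIV :: int list set)" by simp
  have "steps_upto n -` {xs} \<inter> space M \<in> sets M" for xs
  proof (cases "length xs = n")
    case True
    have "{\<omega> \<in> space M. \<forall>i\<in>{..<n}. X (Suc i) \<omega> = xs ! i} \<in> sets M"
    proof (rule sets.sets_Collect_finite_All)
      fix i assume "i \<in> {..<n}"
      have "X (Suc i) -` {xs ! i} \<inter> space M \<in> sets M"
        by (rule measurable_sets[OF measurable_X]) simp_all
      moreover have "X (Suc i) -` {xs ! i} \<inter> space M = {\<omega> \<in> space M. X (Suc i) \<omega> = xs ! i}" by auto
      ultimately show "{\<omega> \<in> space M. X (Suc i) \<omega> = xs ! i} \<in> sets M" by simp
    qed simp
    also have "{\<omega> \<in> space M. \<forall>i\<in>{..<n}. X (Suc i) \<omega> = xs ! i} = steps_upto n -` {xs} \<inter> space M"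
      using True by (auto simp: steps_upto_eq_iff)
    finally show ?thesis .
  next
    case False
    then have "steps_upto n -` {xs} \<inter> space M = {}" by auto
    then show ?thesis by simp
  qed
  then show "steps_upto n \<in> space M \<rightarrow> UNIV \<and> (\<forall>xs\<in>UNIV. steps_upto n -` {xs} \<inter> space M \<in> sets M)"
    by simp
qed

lemma prob_steps_upto:
  assumes "xs \<in> walks n"
  shows "prob {\<omega> \<in> space M. steps_upto n \<omega> = xs} = (1/2) ^ n"
proof (cases "n = 0")
  case True
  then show ?thesis using assms by (simp add: steps_upto_def walks_def prob_space)
next
  case False
  let ?E = "\<lambda>i. {xs ! (i - 1)}"
  have len: "length xs = n" using assms by (simp add: walks_def)
  have "{\<omega> \<in> space M. steps_upto n \<omega> = xs} = (\<Inter>i\<in>{1..n}. X i -` ?E i \<inter> space M)"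
  proof -
    have "(\<forall>i<n. X (Suc i) \<omega> = xs ! i) \<longleftrightarrow> (\<forall>i\<in>{1..n}. X i \<omega> = xs ! (i - 1))" for \<omega>
      by (auto simp: Ball_def) (metis One_nat_def Suc_le_eq Suc_pred diff_Suc_1 less_eq_Suc_le)
    then show ?thesis using False len by (auto simp: steps_upto_eq_iff)
  qed
  then have "prob {\<omega> \<in> space M. steps_upto n \<omega> = xs} = (\<Prod>i\<in>{1..n}. prob (X i -` ?E i \<inter> space M))"
    using indep_varsD[OF indep_steps, of "{1..n}" ?E] False by simp
  also have "\<dots> = (\<Prod>i\<in>{1..n}. 1 / 2)"
  proof (rule prod.cong)
    fix i assume i: "i \<in> {1..n}"
    then have "xs ! (i - 1) \<in> {1, -1}" using assms len by (auto simp: walks_def dest!: subsetD intro!: nth_mem)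
    then show "prob (X i -` ?E i \<inter> space M) = 1 / 2"
      using prob_step_up[of i] prob_step_down[of i] i by (auto simp: vimage_def Int_def conj_commute)
  qed simp
  finally show ?thesis by simp
qed

lemma AE_step: "1 \<le> i \<Longrightarrow> AE \<omega> in M. X i \<omega> \<in> {1, -1}"
proof -
  assume i: "1 \<le> i"
  note [measurable] = measurable_X[OF i]
  have "prob {\<omega> \<in> space M. X i \<omega> \<in> {1, -1}}
      = prob ({\<omega> \<in> space M. X i \<omega> = 1} \<union> {\<omega> \<in> space M. X i \<omega> = -1})"
    by (rule arg_cong[of _ _ prob]) auto
  also have "\<dots> = 1"
    using prob_step_up[OF i] prob_step_down[OF i] by (subst finite_measure_Union) auto
  finally show ?thesis by (subst (asm) prob_Collect_eq_1) auto
qed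

text \<open>The first \<open>n\<close> steps are almost surely a list of signs, and each such list has probability
  \<open>(1/2) ^ n\<close>; counting lists therefore bounds probabilities.\<close>

lemma prob_steps_upto_le: "prob {\<omega> \<in> space M. P (steps_upto n \<omega>)} \<le> card {xs \<in> walks n. P xs} / 2 ^ n"
proof -
  note [measurable] = measurable_steps_upto
  have "AE \<omega> in M. \<forall>i\<in>{..<n}. X (Suc i) \<omega> \<in> {1, -1}"
    using AE_step by (intro AE_finite_allI) auto
  then have AE_walks: "AE \<omega> in M. steps_upto n \<omega> \<in> walks n"
    by eventually_elim (auto simp: walks_def steps_upto_def)
  have "prob {\<omega> \<in> space M. P (steps_upto n \<omega>)} \<le>
      prob (\<Union>xs\<in>{xs \<in> walks n. P xs}. {\<omega> \<in> space M. steps_upto n \<omega> = xs})"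
    using AE_walks by (intro finite_measure_mono_AE) auto
  also have "\<dots> \<le> (\<Sum>xs\<in>{xs \<in> walks n. P xs}. prob {\<omega> \<in> space M. steps_upto n \<omega> = xs})"
    by (intro finite_measure_subadditive_finite) auto
  also have "\<dots> = (\<Sum>xs\<in>{xs \<in> walks n. P xs}. (1/2) ^ n)"
    by (intro sum.cong prob_steps_upto) auto
  also have "\<dots> = card {xs \<in> walks n. P xs} / 2 ^ n" by (simp add: power_one_over)
  finally show ?thesis .
qed

lemma prob_small_LIS_le:
  fixes x :: real
  assumes "0 < n"
  shows "prob {\<omega> \<in> space M. LIS (\<lambda>k. walk X k \<omega>) {0..<n} < x}
    \<le> 2 * 2 ^ J / sqrt n + exp (x / 2 ^ J - J / 4)"
  unfolding LIS_walk_eq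
  using prob_steps_upto_le[of "\<lambda>xs. LIS (height xs) {0..<n} < x" n]
    small_LIS_fraction_le[OF assms, of x J]
  by linarith

lemma integrable_LIS_walk: "integrable M (\<lambda>\<omega>. real (LIS (\<lambda>k. walk X k \<omega>) {0..<n}))"
proof (rule integrable_const_bound[where B = n])
  have "LIS (\<lambda>k. walk X k \<omega>) {0..<n} \<le> n" for \<omega>
    using LIS_le_card[of "{0..<n}" "\<lambda>k. walk X k \<omega>"] by simp
  then show "AE \<omega> in M. norm (real (LIS (\<lambda>k. walk X k \<omega>) {0..<n})) \<le> n"
    by (intro AE_I2) simp
  have "(\<lambda>xs. real (LIS (height xs) {0..<n})) \<in> measurable (count_space UNIV) borel"
    by simp
  from measurable_compose[OF measurable_steps_upto this]
  show "(\<lambda>\<omega>. real (LIS (\<lambda>k. walk X k \<omega>) {0..<n})) \<in> borel_measurable M"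
    by (simp add: LIS_walk_eq)
qed

lemma expectation_LIS_ge:
  fixes c :: real
  assumes "prob {\<omega> \<in> space M. LIS (\<lambda>k. walk X k \<omega>) {0..<n} < c} \<le> 1 / 2" and c: "0 \<le> c"
  shows "c / 2 \<le> expectation (\<lambda>\<omega>. real (LIS (\<lambda>k. walk X k \<omega>) {0..<n}))"
proof -
  let ?L = "\<lambda>\<omega>. real (LIS (\<lambda>k. walk X k \<omega>) {0..<n})"
  note [measurable] = borel_measurable_integrable[OF integrable_LIS_walk[of n]]
  let ?A = "{\<omega> \<in> space M. c \<le> ?L \<omega>}"
  have A: "?A \<in> events" by measurable
  have "space M - ?A = {\<omega> \<in> space M. ?L \<omega> < c}" by auto
  then have "1 - prob ?A \<le> 1 / 2" using prob_compl[OF A] assms(1) by simp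
  then have "c * (1 / 2) \<le> c * prob ?A" using c by (intro mult_left_mono) auto
  also have "\<dots> = expectation (\<lambda>\<omega>. c * indicator ?A \<omega>)" using A by simp
  also have "\<dots> \<le> expectation ?L"
    using A by (intro integral_mono integrable_LIS_walk integrable_mult_right integrable_real_indicator)
      (auto simp: indicator_def emeasure_eq_measure)
  finally show ?thesis by simp
qed

end

section \<open>Choice of the scale\<close>

lemma eventually_ge_log:
  "\<forall>\<^sub>F n in sequentially. K \<le> log 2 (real n)"
  using eventually_ge_at_top[of "nat \<lceil>2 powr K\<rceil>"]
proof eventually_elim
  case (elim n)
  then have "2 powr K \<le> real n" by linarith
  moreover have "0 < (2::real) powr K" by simp
  ultimately have "0 < real n" by linarith
  then show ?case using \<open>2 powr K \<le> real n\<close> by (simp add: le_log_iff)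
qed

text \<open>The scale \<open>2 ^ J\<close> is the least power of two above \<open>32 * \<epsilon> * sqrt n\<close>. Since \<open>J\<close> is about half of
  \<open>log 2 n\<close>, hence eventually at least a quarter of it, the exponent is at most
  \<open>log 2 n / 32 - log 2 n / 16\<close>, which tends to minus infinity.\<close>

lemma eventually_scale:
  fixes \<epsilon> :: real
  assumes \<epsilon>: "0 < \<epsilon>"
  shows "\<forall>\<^sub>F n in sequentially. \<exists>J. 2 * 2 ^ J / sqrt n
    + exp (\<epsilon> * sqrt n * log 2 n / 2 ^ J - real J / 4) \<le> 250 * \<epsilon>"
  using eventually_ge_log[of 1] eventually_ge_log[of "-4 * log 2 (32 * \<epsilon>)"]
    eventually_ge_log[of "-32 * ln (122 * \<epsilon>)"] eventually_gt_at_top[of 0]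
proof eventually_elim
  case (elim n)
  define L where "L = log 2 (real n)"
  have L: "1 \<le> L" "-4 * log 2 (32 * \<epsilon>) \<le> L" "-32 * ln (122 * \<epsilon>) \<le> L"
    using elim unfolding L_def by blast+
  define y where "y = 32 * \<epsilon> * sqrt n"
  have n: "0 < sqrt (real n)" using elim by simp
  then have y: "0 < y" using \<epsilon> by (simp add: y_def)
  have "log 2 y = log 2 (32 * \<epsilon>) + log 2 (sqrt n)"
    unfolding y_def using \<epsilon> n by (intro log_mult_pos) auto
  also have "log 2 (sqrt n) = L / 2"
    using elim by (simp add: L_def log_def ln_sqrt)
  finally have log_y: "L / 4 \<le> log 2 y" "0 \<le> log 2 y" using L by linarith+
  define J where "J = nat \<lceil>log 2 y\<rceil>"
  have J: "log 2 y \<le> J" "J < log 2 y + 1" using log_y by (simp_all add: J_def) linarith+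
  have "y = 2 powr log 2 y" using y by simp
  also have "\<dots> \<le> 2 powr J" using J by (intro powr_mono) auto
  finally have low: "y \<le> 2 ^ J" by (simp add: powr_realpow)
  have "2 ^ J = 2 powr J" by (simp add: powr_realpow)
  also have "\<dots> \<le> 2 powr (log 2 y + 1)" using J by (intro powr_mono) auto
  also have "\<dots> = 2 * y" using y by (simp add: powr_add)
  finally have up: "2 ^ J \<le> 2 * y" .
  have "2 * 2 ^ J / sqrt n \<le> 2 * (2 * y) / sqrt n" using up n by (intro divide_right_mono) auto
  also have "\<dots> = 128 * \<epsilon>" using n by (simp add: y_def)
  finally have first: "2 * 2 ^ J / sqrt n \<le> 128 * \<epsilon>" .
  have "\<epsilon> * sqrt n * L / 2 ^ J \<le> \<epsilon> * sqrt n * L / y"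
    using low y \<epsilon> n L(1) by (intro divide_left_mono mult_nonneg_nonneg mult_pos_pos) auto
  also have "\<dots> = L / 32" using \<epsilon> n by (simp add: y_def)
  finally have "\<epsilon> * sqrt n * L / 2 ^ J - J / 4 \<le> ln (122 * \<epsilon>)"
    using J(1) log_y(1) L(3) by linarith
  then have "exp (\<epsilon> * sqrt n * L / 2 ^ J - J / 4) \<le> exp (ln (122 * \<epsilon>))" by simp
  also have "\<dots> = 122 * \<epsilon>" using \<epsilon> by simp
  finally show ?case using first unfolding L_def by (intro exI[of _ J]) linarith
qed

theorem theorem2:
  fixes M :: "'a measure" and X :: "nat \<Rightarrow> 'a \<Rightarrow> int"
  assumes "simple_random_walk M X"
  shows "(\<forall>\<epsilon>::real. \<epsilon> > 0 \<longrightarrow>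
            (\<forall>\<^sub>F n in sequentially.
               measure M {\<omega> \<in> space M.
                 real (LIS (\<lambda>k. walk X k \<omega>) {0..<n}) < \<epsilon> * sqrt (real n) * log 2 (real n)}
               \<le> 250 * \<epsilon>)) \<and>
         (\<forall>\<^sub>F n in sequentially.
            (\<integral>\<omega>. real (LIS (\<lambda>k. walk X k \<omega>) {0..<n}) \<partial>M)
            \<ge> 1 / 1000 * sqrt (real n) * log 2 (real n))"
proof -
  interpret simple_random_walk M X by fact
  have tail: "\<forall>\<^sub>F n in sequentially.
      prob {\<omega> \<in> space M. real (LIS (\<lambda>k. walk X k \<omega>) {0..<n}) < \<epsilon> * sqrt (real n) * log 2 (real n)}
      \<le> 250 * \<epsilon>" if "0 < \<epsilon>" for \<epsilon> :: real
    using eventually_scale[OF that] eventually_gt_at_top[of 0]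
  proof eventually_elim
    case (elim n)
    then show ?case using prob_small_LIS_le[OF elim(2)] order_trans by blast
  qed
  have small: "0 < (1 / 500 :: real)" by simp
  have "\<forall>\<^sub>F n in sequentially. expectation (\<lambda>\<omega>. real (LIS (\<lambda>k. walk X k \<omega>) {0..<n}))
      \<ge> 1 / 1000 * sqrt (real n) * log 2 (real n)"
    using tail[OF small] eventually_ge_log[of 0]
  proof eventually_elim
    case (elim n)
    then show ?case
      using expectation_LIS_ge[of n "1 / 500 * sqrt (real n) * log 2 (real n)"] by simp
  qed
  then show ?thesis using tail by blast
qed

end
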